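(* Let $X$ be a perfect Polish space and let $A\subseteq X$. The following are equivalent: (1) $A$ is countably perfectly meager in $X$. (2) For every continuous bijection $f:\mathbb{N}^{\mathbb{N}}\to X$ there are closed sets $F_n$ in $X$ ($n\in\mathbb{N}$) such that $A\subseteq\bigcup_n F_n$ and $f^{-1}(F_n)$ is nowhere dense in $\mathbb{N}^{\mathbb{N}}$ for each $n\in\mathbb{N}$.
   Context: A perfect Polish space is a separable completely metrizable topological space with no isolated points. A perfect set is a non-empty closed set with no isolated points. $\mathbb{N}^{\mathbb{N}}$ is the Baire space with the product topology. A subset $A$ of a perfect Polish space $X$ is countably perfectly meager in $X$ if for every sequence $\{P_n : n\in\mathbb{N}\}$ of perfect subsets of $X$ there exists an $F_\sigma$-set $F$ in $X$ such that $A\subseteq F$ and $F\cap P_n$ is meager in $P_n$ for each $n$. *)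

theory Defs
  imports "HOL-Analysis.Analysis"
begin

definition no_isolated_points :: "'a topology \<Rightarrow> bool"
  where "no_isolated_points X \<longleftrightarrow> (\<forall>x\<in>topspace X. \<not> openin X {x})"

definition perfect_polish_space :: "'a topology \<Rightarrow> bool"
  where "perfect_polish_space X \<longleftrightarrow>
    separable_space X \<and> completely_metrizable_space X \<and> no_isolated_points X"

text \<open>Isolated points of \<open>P\<close> are meant in the subspace topology.\<close>
definition perfect_set_in :: "'a topology \<Rightarrow> 'a set \<Rightarrow> bool"
  where "perfect_set_in X P \<longleftrightarrow>
    P \<noteq> {} \<and> closedin X P \<and> no_isolated_points (subtopology X P)"

text \<open>The inclusion in \<open>topspace X\<close> is needed because \<open>closure_of\<close> ignores points outside it.\<close>
definition nowhere_dense_in :: "'a topology \<Rightarrow> 'a set \<Rightarrow> bool"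
  where "nowhere_dense_in X S \<longleftrightarrow>
    S \<subseteq> topspace X \<and> X interior_of (X closure_of S) = {}"

definition meager_in :: "'a topology \<Rightarrow> 'a set \<Rightarrow> bool"
  where "meager_in X S \<longleftrightarrow>
    (\<exists>N :: nat \<Rightarrow> 'a set. (\<forall>n. nowhere_dense_in X (N n)) \<and> S = (\<Union>n. N n))"

definition countably_perfectly_meager_in :: "'a topology \<Rightarrow> 'a set \<Rightarrow> bool"
  where "countably_perfectly_meager_in X A \<longleftrightarrow>
    A \<subseteq> topspace X \<and>
    (\<forall>P :: nat \<Rightarrow> 'a set. (\<forall>n. perfect_set_in X (P n)) \<longrightarrow>
      (\<exists>F. fsigma_in X F \<and> A \<subseteq> F \<and> (\<forall>n. meager_in (subtopology X (P n)) (F \<inter> P n))))"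

definition baire_space :: "(nat \<Rightarrow> nat) topology"
  where "baire_space = product_topology (\<lambda>_. discrete_topology UNIV) UNIV"

lemma topspace_baire_space [simp]: "topspace baire_space = UNIV"
  by (simp add: baire_space_def)

end

theory Submission
  imports Defs
begin

text \<open>
  If \<open>f\<close> is a continuous bijection from the Baire space onto \<open>X\<close>, the closures of the images of basic
  open sets are countably many perfect sets. A closed set that is meager in each of them cannot contain
  any of them, so its preimage has no interior. This gives one direction
  (\<open>countably_perfectly_meager_imp_nowhere_dense_preimages\<close>).

  For the converse, given perfect sets \<open>P n\<close>, it suffices to find one continuous bijection \<open>f\<close> such
  that \<open>f -` Q\<close> has nonempty interior whenever \<open>Q\<close> is the closure of a nonempty basic open
  part of some \<open>P n\<close>: a closed set with nowhere dense preimage then contains no such \<open>Q\<close>, hence is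
  nowhere dense in every \<open>P n\<close>. As there are only countably many such \<open>Q\<close>, all reduces to
  \<open>continuous_bijection_with_fat_preimages\<close>.

  That bijection comes from a Lusin scheme. Its sets are nonempty \<open>G\<^sub>\<delta>\<close> sets that are dense in
  themselves, that is, perfect Polish subspaces. The key point is that such a set can be partitioned into
  infinitely many arbitrarily small sets of the same kind: \<open>subordinate_partition\<close> makes the
  pieces small and \<open>infinite_gdelta_partition\<close> makes them infinite in number. Moreover one piece may be
  placed inside a prescribed closed set \<open>Q\<close>, provided that the part of \<open>Q\<close> in the set being
  partitioned contains a nonempty set dense in itself (\<open>branching_gdelta_partition\<close>). Since each level
  of the scheme is a countable partition of \<open>X\<close>, the Baire category theorem in \<open>Q\<close> finds on any
  level a set that meets this proviso. Each \<open>Q\<close> is treated on its own level, and the piece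
  inside \<open>Q\<close> corresponds to a basic open set of the Baire space.
\<close>

section \<open>Sets dense in themselves\<close>

definition dense_in_itself :: "'a topology \<Rightarrow> 'a set \<Rightarrow> bool"
  where "dense_in_itself X S \<longleftrightarrow> S \<subseteq> X derived_set_of S"

text \<open>
  In a Polish space these sets are exactly the nonempty subspaces that are perfect Polish spaces.
\<close>

definition perfect_gdelta :: "'a topology \<Rightarrow> 'a set \<Rightarrow> bool"
  where "perfect_gdelta X S \<longleftrightarrow> S \<noteq> {} \<and> gdelta_in X S \<and> dense_in_itself X S"

lemma dense_in_itself_subset_topspace: "dense_in_itself X S \<Longrightarrow> S \<subseteq> topspace X"
  unfolding dense_in_itself_def by (rule order_trans[OF _ derived_set_of_subset_topspace])

lemma dense_in_itself_iff_no_isolated_points: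
  assumes "S \<subseteq> topspace X"
  shows "dense_in_itself X S \<longleftrightarrow> no_isolated_points (subtopology X S)"
proof -
  have top: "topspace (subtopology X S) = S"
    using assms by (simp add: topspace_subtopology Int_absorb1)
  have "openin (subtopology X S) {x} \<longleftrightarrow> x \<notin> X derived_set_of S" if "x \<in> S" for x
  proof -
    have "openin (subtopology X S) {x} \<longleftrightarrow> (\<exists>T. openin X T \<and> {x} = T \<inter> S)"
      by (simp add: openin_subtopology)
    also have "\<dots> \<longleftrightarrow> \<not> (\<forall>T. x \<in> T \<and> openin X T \<longrightarrow> (\<exists>y\<noteq>x. y \<in> S \<and> y \<in> T))"
      using that by blast
    also have "\<dots> \<longleftrightarrow> x \<notin> X derived_set_of S"
      using that assms unfolding derived_set_of_def by blast
    finally show ?thesis .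
  qed
  then show ?thesis
    unfolding dense_in_itself_def no_isolated_points_def top by blast
qed

lemma dense_in_itself_openin_Int:
  assumes "dense_in_itself X S" "openin X U"
  shows "dense_in_itself X (S \<inter> U)"
  using assms openin_Int_derived_set_of_subset[OF assms(2), of S]
  unfolding dense_in_itself_def by (auto simp: Int_commute)

lemma dense_in_itself_Union:
  assumes "\<And>S. S \<in> \<S> \<Longrightarrow> dense_in_itself X S"
  shows "dense_in_itself X (\<Union>\<S>)"
proof -
  have "S \<subseteq> X derived_set_of \<Union>\<S>" if "S \<in> \<S>" for S
    using assms[OF that] derived_set_of_mono[of S "\<Union>\<S>" X] that
    unfolding dense_in_itself_def by blast
  then show ?thesis
    unfolding dense_in_itself_def by blast
qed

text \<open>
  This is what repairs boundaries: a boundary point may be attached to any open piece that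
  accumulates at it without creating an isolated point.
\<close>

lemma dense_in_itself_between_closure:
  assumes "dense_in_itself X W" "W \<subseteq> S" "S \<subseteq> X closure_of W"
  shows "dense_in_itself X S"
proof -
  have "X closure_of W \<subseteq> X derived_set_of W"
    using assms(1) unfolding closure_of dense_in_itself_def by blast
  also have "\<dots> \<subseteq> X derived_set_of S"
    by (rule derived_set_of_mono[OF assms(2)])
  finally show ?thesis
    using assms(3) unfolding dense_in_itself_def by (rule order_trans[rotated])
qed

lemma dense_in_itself_dense_subset:
  assumes "t1_space X" "dense_in_itself X S" "T \<subseteq> S" "S \<subseteq> X closure_of T"
  shows "dense_in_itself X T"
  unfolding dense_in_itself_def
proof
  fix x assume "x \<in> T"
  then have "x \<in> X derived_set_of S"
    using assms(2,3) unfolding dense_in_itself_def by (meson subsetD)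
  then have x: "x \<in> topspace X" "\<And>U. x \<in> U \<Longrightarrow> openin X U \<Longrightarrow> \<exists>y. y \<noteq> x \<and> y \<in> S \<and> y \<in> U"
    by (auto simp: in_derived_set_of)
  show "x \<in> X derived_set_of T"
    unfolding in_derived_set_of
  proof (intro conjI allI impI)
    show "x \<in> topspace X" by (rule x(1))
    fix U assume U: "x \<in> U \<and> openin X U"
    then obtain y where y: "y \<noteq> x" "y \<in> S" "y \<in> U"
      using x(2) by meson
    have "openin X (U - {x})"
      using U x(1) assms(1) by (simp add: openin_diff closedin_t1_singleton)
    moreover have "y \<in> X closure_of T"
      using assms(4) y(2) by (rule subsetD)
    ultimately show "\<exists>y. y \<noteq> x \<and> y \<in> T \<and> y \<in> U"
      using y unfolding in_closure_of by (metis DiffE DiffI singletonD singletonI)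
  qed
qed

section \<open>Partitions into \<open>G\<^sub>\<delta>\<close> sets without isolated points\<close>

text \<open>
  The naive disjointification \<open>U n - (\<Union>m<n. U m)\<close> may have isolated points, namely on the
  boundaries. Removing closures instead gives disjoint relatively open sets \<open>W n\<close>; these are dense
  in themselves but miss the boundaries. Every point \<open>y\<close> of \<open>U n\<close> lies in the closure of some
  \<open>W j\<close> with \<open>j \<le> n\<close>: in any neighbourhood \<open>E\<close> of \<open>y\<close>, the first \<open>U j\<close> that meets \<open>Y \<inter> E\<close>
  provides a point of \<open>W j\<close>. So \<open>y\<close> can be given to the first \<open>W j\<close> that accumulates at it. Each
  piece is cut out by a difference of two closed sets, which is both \<open>F\<^sub>\<sigma>\<close> and \<open>G\<^sub>\<delta>\<close>; that both
  hold is what makes unions of pieces manageable later.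
\<close>

lemma subordinate_partition:
  fixes U :: "nat \<Rightarrow> 'a set"
  assumes "metrizable_space X" and Y: "dense_in_itself X Y"
    and U: "\<And>n. openin X (U n)" and cover: "Y \<subseteq> (\<Union>n. U n)"
  obtains D :: "nat \<Rightarrow> 'a set"
  where "\<And>n. gdelta_in X (D n)" "\<And>n. fsigma_in X (D n)"
    "disjoint_family D" "Y \<subseteq> (\<Union>n. D n)"
    "\<And>n. dense_in_itself X (Y \<inter> D n)"
    "\<And>n. D n \<subseteq> X closure_of U n" "\<And>m n. m < n \<Longrightarrow> D n \<inter> U m = {}"
proof -
  define E where "E n = U n - X closure_of (\<Union>m<n. Y \<inter> U m)" for n
  define W where "W n = Y \<inter> E n" for n
  define D where "D n = X closure_of W n - (\<Union>m<n. X closure_of W m)" for n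
  have Ysub: "Y \<subseteq> topspace X"
    using Y by (rule dense_in_itself_subset_topspace)
  have openO: "openin X (E n)" for n
    unfolding E_def by (simp add: U openin_diff)
  have WU: "W n \<subseteq> Y \<inter> U n" for n
    unfolding W_def E_def by blast
  have W_top: "W n \<subseteq> topspace X" for n
    using WU Ysub by blast
  have WW: "W n \<inter> X closure_of W m = {}" if "m < n" for m n
  proof -
    have "X closure_of W m \<subseteq> X closure_of (\<Union>m<n. Y \<inter> U m)"
      using that WU by (intro closure_of_mono) blast
    then show ?thesis
      unfolding W_def E_def by blast
  qed
  have W_Um: "W n \<inter> U m = {}" if "m < n" for m n
  proof -
    have "(\<Union>m<n. Y \<inter> U m) \<subseteq> X closure_of (\<Union>m<n. Y \<inter> U m)"
      using Ysub by (intro closure_of_subset) blast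
    then show ?thesis
      using that unfolding W_def E_def by blast
  qed
  have W_sub_D: "W n \<subseteq> D n" for n
    using WW closure_of_subset[OF W_top] unfolding D_def by fastforce
  have D_fin: "closedin X (\<Union>m<n. X closure_of W m)" for n
    by (intro closedin_Union) auto
  have D_diff: "D n = X closure_of W n \<inter> (topspace X - (\<Union>m<n. X closure_of W m))" for n
    unfolding D_def using closure_of_subset_topspace by fastforce
  show thesis
  proof
    show "gdelta_in X (D n)" for n
      unfolding D_diff using assms(1) D_fin
      by (intro gdelta_in_Int) (auto simp: closed_imp_gdelta_in open_imp_gdelta_in openin_diff)
    show "fsigma_in X (D n)" for n
      unfolding D_diff using assms(1) D_fin
      by (intro fsigma_in_Int) (auto simp: closed_imp_fsigma_in open_imp_fsigma_in openin_diff)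
    show "disjoint_family D"
      unfolding disjoint_family_on_def
    proof (intro ballI impI)
      fix m n :: nat assume "m \<noteq> n"
      then show "D m \<inter> D n = {}"
        by (cases m n rule: linorder_cases) (auto simp: D_def)
    qed
    show "Y \<subseteq> (\<Union>n. D n)"
    proof
      fix y assume y: "y \<in> Y"
      then obtain n where n: "y \<in> U n"
        using cover by blast
      have "y \<in> X closure_of (\<Union>j\<le>n. W j)"
        unfolding in_closure_of
      proof (intro conjI allI impI)
        show "y \<in> topspace X" using y Ysub by blast
        fix T assume T: "y \<in> T \<and> openin X T"
        define j where "j = (LEAST j. Y \<inter> U j \<inter> T \<noteq> {})"
        have ex: "Y \<inter> U n \<inter> T \<noteq> {}"
          using y n T by blast
        have j: "Y \<inter> U j \<inter> T \<noteq> {}" "j \<le> n"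
          unfolding j_def using ex by (rule LeastI, rule Least_le)
        have "Y \<inter> U m \<inter> T = {}" if "m < j" for m
          using not_less_Least[of m "\<lambda>j. Y \<inter> U j \<inter> T \<noteq> {}"] that unfolding j_def by blast
        then have "T \<inter> X closure_of (\<Union>m<j. Y \<inter> U m) = {}"
          using T openin_Int_closure_of_eq_empty[of X T "\<Union>m<j. Y \<inter> U m"] by blast
        then show "\<exists>z. z \<in> (\<Union>j\<le>n. W j) \<and> z \<in> T"
          using j unfolding W_def E_def by blast
      qed
      also have "X closure_of (\<Union>j\<le>n. W j) = (\<Union>j\<le>n. X closure_of W j)"
        using closure_of_Union[of "W ` {..n}" X] by simp
      finally have ex: "\<exists>j. y \<in> X closure_of W j" by blast
      define j where "j = (LEAST j. y \<in> X closure_of W j)"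
      have "y \<in> X closure_of W j"
        unfolding j_def using ex by (rule LeastI_ex)
      moreover have "y \<notin> X closure_of W m" if "m < j" for m
        using not_less_Least[of m "\<lambda>j. y \<in> X closure_of W j"] that unfolding j_def by blast
      ultimately show "y \<in> (\<Union>n. D n)"
        unfolding D_def by blast
    qed
    show "dense_in_itself X (Y \<inter> D n)" for n
    proof (rule dense_in_itself_between_closure)
      show "dense_in_itself X (W n)"
        unfolding W_def using Y openO by (rule dense_in_itself_openin_Int)
      show "W n \<subseteq> Y \<inter> D n" using W_sub_D WU by blast
      show "Y \<inter> D n \<subseteq> X closure_of W n" unfolding D_def by blast
    qed
    show "D n \<subseteq> X closure_of U n" for n
      unfolding D_def using closure_of_mono[of "W n" "U n" X] WU by blast
    show "D n \<inter> U m = {}" if "m < n" for m n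
      using openin_Int_closure_of_eq_empty[OF U, of m "W n"] W_Um[OF that]
      unfolding D_def by blast
  qed
qed

definition gdelta_partition :: "'a topology \<Rightarrow> 'a set \<Rightarrow> 'a set set \<Rightarrow> bool"
  where "gdelta_partition X Y \<P> \<longleftrightarrow>
    partition_on Y \<P> \<and> countable \<P> \<and> (\<forall>P\<in>\<P>. perfect_gdelta X P)"

lemma gdelta_partition_refine:
  assumes P: "gdelta_partition X Y \<P>"
    and Q: "\<And>P. P \<in> \<P> \<Longrightarrow> gdelta_partition X P (\<Q> P)"
  shows "gdelta_partition X Y (\<Union>P\<in>\<P>. \<Q> P)"
    and "infinite \<P> \<Longrightarrow> infinite (\<Union>P\<in>\<P>. \<Q> P)"
proof -
  have Y: "Y = \<Union>\<P>" and disj: "\<And>P P'. P \<in> \<P> \<Longrightarrow> P' \<in> \<P> \<Longrightarrow> P \<noteq> P' \<Longrightarrow> P \<inter> P' = {}"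
    and neP: "{} \<notin> \<P>" and cP: "countable \<P>"
    using P unfolding gdelta_partition_def partition_on_def disjoint_def by auto
  have UQ: "\<Union>(\<Q> P) = P" and neQ: "{} \<notin> \<Q> P" and cQ: "countable (\<Q> P)"
    and disjQ: "\<And>S S'. S \<in> \<Q> P \<Longrightarrow> S' \<in> \<Q> P \<Longrightarrow> S \<noteq> S' \<Longrightarrow> S \<inter> S' = {}"
    and perfQ: "\<And>S. S \<in> \<Q> P \<Longrightarrow> perfect_gdelta X S" if "P \<in> \<P>" for P
    using Q[OF that] unfolding gdelta_partition_def partition_on_def disjoint_def by auto
  have disj2: "S \<inter> S' = {}"
    if "P \<in> \<P>" "S \<in> \<Q> P" "P' \<in> \<P>" "S' \<in> \<Q> P'" "S \<noteq> S'" for S S' P P'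
  proof (cases "P = P'")
    case True with that disjQ show ?thesis by metis
  next
    case False
    have "S \<subseteq> P" "S' \<subseteq> P'" using that UQ by auto
    with disj[OF that(1,3) False] show ?thesis by auto
  qed
  have "\<Union>(\<Union>P\<in>\<P>. \<Q> P) = Y"
  proof -
    have "\<Union>(\<Union>P\<in>\<P>. \<Q> P) = (\<Union>P\<in>\<P>. \<Union>(\<Q> P))" by blast
    also have "\<dots> = Y" unfolding Y using UQ by simp
    finally show ?thesis .
  qed
  moreover have "disjoint (\<Union>P\<in>\<P>. \<Q> P)"
    unfolding disjoint_def using disj2 by (metis UN_E)
  ultimately show "gdelta_partition X Y (\<Union>P\<in>\<P>. \<Q> P)"
    unfolding gdelta_partition_def partition_on_def using neQ cP cQ perfQ by auto
  show "infinite (\<Union>P\<in>\<P>. \<Q> P)" if inf: "infinite \<P>"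
  proof
    assume fin: "finite (\<Union>P\<in>\<P>. \<Q> P)"
    define g where "g P = (SOME S. S \<in> \<Q> P)" for P
    have g: "g P \<in> \<Q> P" if "P \<in> \<P>" for P
    proof -
      have "\<Q> P \<noteq> {}" using UQ[OF that] that neP by auto
      then show ?thesis unfolding g_def by (rule some_in_eq[THEN iffD2])
    qed
    have "inj_on g \<P>"
    proof (rule inj_onI)
      fix P P' assume PP: "P \<in> \<P>" "P' \<in> \<P>" "g P = g P'"
      have "g P \<subseteq> P \<inter> P'"
        using g[OF PP(1)] g[OF PP(2)] PP(3) UQ[OF PP(1)] UQ[OF PP(2)] by auto
      moreover have "g P \<noteq> {}" using g[OF PP(1)] neQ[OF PP(1)] by metis
      ultimately show "P = P'" using disj[OF PP(1,2)] by auto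
    qed
    moreover have "g ` \<P> \<subseteq> (\<Union>P\<in>\<P>. \<Q> P)" using g by auto
    ultimately show False
      using inf fin by (meson finite_subset finite_imageD)
  qed
qed

lemma perfect_gdelta_openin_Int:
  assumes "perfect_gdelta X S" "openin X U" "S \<inter> U \<noteq> {}"
  shows "perfect_gdelta X (S \<inter> U)"
  using assms dense_in_itself_openin_Int[of X S U]
  by (auto simp: perfect_gdelta_def gdelta_in_Int open_imp_gdelta_in)

text \<open>
  Infinitely many pieces are needed because the scheme is to be indexed by all of the Baire space,
  while \<open>Y\<close> may be compact. Fix \<open>y \<in> Y\<close> and partition \<open>Y - {y}\<close> subordinately to the complements
  of shrinking balls around \<open>y\<close>. Since \<open>y\<close> is not isolated, infinitely many pieces are nonempty, and
  they converge to \<open>y\<close>. Adding \<open>y\<close> to the union of infinitely many of them keeps it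
  from being isolated; infinitely many others remain as separate pieces.
\<close>

lemma (in Metric_space) infinite_gdelta_partition:
  assumes Y: "perfect_gdelta mtopology Y"
  obtains \<P> where "gdelta_partition mtopology Y \<P>" "infinite \<P>"
proof -
  have dii: "dense_in_itself mtopology Y" and gd: "gdelta_in mtopology Y"
    using Y by (auto simp: perfect_gdelta_def)
  have YM: "Y \<subseteq> M"
    using dense_in_itself_subset_topspace[OF dii] by simp
  obtain y where y: "y \<in> Y"
    using Y by (auto simp: perfect_gdelta_def)
  then have yM: "y \<in> M" using YM by auto
  define U where "U n = M - mcball y (1 / real (Suc n))" for n
  have openU: "openin mtopology (U n)" for n
    unfolding U_def by (metis closedin_mcball closedin_def topspace_mtopology)
  have "closedin mtopology {y}"
    using yM by (simp add: closedin_t1_singleton t1_space_mtopology)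
  then have open': "openin mtopology (M - {y})"
    by (metis closedin_def topspace_mtopology)
  define Y' where "Y' = Y \<inter> (M - {y})"
  have Y'_eq: "Y' = Y - {y}" unfolding Y'_def using YM by auto
  have diiY': "dense_in_itself mtopology Y'"
    unfolding Y'_def using dii open' by (rule dense_in_itself_openin_Int)
  have gdY': "gdelta_in mtopology Y'"
    unfolding Y'_def by (rule gdelta_in_Int[OF gd open_imp_gdelta_in[OF open']])
  have cover: "Y' \<subseteq> (\<Union>n. U n)"
  proof
    fix z assume z: "z \<in> Y'"
    then have "z \<in> M" "d y z > 0" using YM yM mdist_pos_less unfolding Y'_eq by auto
    moreover obtain n where "1 / real (Suc n) < d y z"
      using \<open>d y z > 0\<close> nat_approx_posE by metis
    ultimately show "z \<in> (\<Union>n. U n)"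
      unfolding U_def by (auto simp: not_le)
  qed
  obtain D where D: "\<And>n. gdelta_in mtopology (D n)" "\<And>n. fsigma_in mtopology (D n)"
    "disjoint_family D" "Y' \<subseteq> (\<Union>n. D n)"
    "\<And>n. dense_in_itself mtopology (Y' \<inter> D n)"
    "\<And>n. D n \<subseteq> mtopology closure_of U n" "\<And>m n. m < n \<Longrightarrow> D n \<inter> U m = {}"
    using subordinate_partition[OF metrizable_space_mtopology diiY' openU cover] by metis
  define R where "R n = Y' \<inter> D n" for n
  define N where "N = {n. R n \<noteq> {}}"
  \<comment> \<open>The pieces stay away from the centre, so no finite number of them accumulates at it.\<close>
  have far: "D n \<inter> mball y (1 / real (Suc n)) = {}" for n
  proof -
    have "U n \<inter> mball y (1 / real (Suc n)) = {}"
      unfolding U_def by auto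
    then have "mball y (1 / real (Suc n)) \<inter> mtopology closure_of U n = {}"
      using openin_Int_closure_of_eq_empty[OF openin_mball] by (metis Int_commute)
    then show ?thesis using D(6)[of n] by auto
  qed
  \<comment> \<open>The pieces converge to the centre.\<close>
  have near: "R n \<subseteq> mcball y (1 / real (Suc m))" if "m < n" for m n
    using D(7)[OF that] YM unfolding U_def R_def Y'_def by auto
  \<comment> \<open>A point of the space closer than \<open>1 / (k + 1)\<close> lies in a piece of index above \<open>k\<close>.\<close>
  have "\<exists>n>k. n \<in> N" for k
  proof -
    have "y \<in> mtopology derived_set_of Y"
      using dii y unfolding dense_in_itself_def by auto
    then obtain z where z: "z \<noteq> y" "z \<in> Y" "z \<in> mball y (1 / real (Suc k))"
      using yM unfolding in_derived_set_of
      by (metis centre_in_mball_iff openin_mball of_nat_0_less_iff zero_less_Suc zero_less_divide_1_iff)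
    then have zY: "z \<in> Y'" by (simp add: Y'_eq)
    then obtain n where n: "z \<in> D n" using D(4) by auto
    have "n > k"
    proof (rule ccontr)
      assume "\<not> k < n"
      then have "1 / real (Suc k) \<le> 1 / real (Suc n)" by (simp add: frac_le)
      then have "z \<in> mball y (1 / real (Suc n))" using z(3) by auto
      with far[of n] n show False by auto
    qed
    with n zY show ?thesis unfolding N_def R_def by blast
  qed
  then have "infinite N" by (simp add: infinite_nat_iff_unbounded)
  then obtain A B where AB: "A \<subseteq> N" "B \<subseteq> N" "infinite A" "infinite B" "A \<inter> B = {}"
    using infinite_split by metis
  have disjR: "R m \<inter> R n = {}" if "m \<noteq> n" for m n
    using D(3) that unfolding R_def disjoint_family_on_def by auto
  \<comment> \<open>Written as a difference to make it visibly \<open>G\<^sub>\<delta>\<close>, 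
     this is the centre together with the pieces whose index is not in \<open>B\<close>.\<close>
  define P0 where "P0 = Y - (\<Union>n\<in>B. D n - {y})"
  define T where "T = Y' - (\<Union>n\<in>B. R n)"
  have P0_alt: "P0 = Y - (\<Union>n\<in>B. R n)"
    unfolding P0_def R_def Y'_eq by auto
  have yP0: "y \<in> P0" unfolding P0_alt R_def Y'_eq using y by auto
  have P0_T: "P0 = insert y T"
    unfolding T_def P0_alt Y'_eq R_def using y by auto
  have T_alt: "T = \<Union>(R ` (-B))"
  proof (intro equalityI subsetI)
    fix p assume p: "p \<in> T"
    then obtain n where "p \<in> D n" using D(4) unfolding T_def by blast
    then have "p \<in> R n" using p by (simp add: T_def R_def)
    with p show "p \<in> \<Union>(R ` (-B))" unfolding T_def by blast
  next
    fix p assume "p \<in> \<Union>(R ` (-B))"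
    then obtain n where n: "p \<in> R n" "n \<notin> B" by auto
    have "p \<notin> R m" if "m \<in> B" for m
      using disjR[of m n] that n by auto
    with n(1) show "p \<in> T" by (auto simp: T_def R_def)
  qed
  have diiT: "dense_in_itself mtopology T"
    unfolding T_alt using D(5) by (intro dense_in_itself_Union) (auto simp: R_def)
  have "y \<in> mtopology closure_of T"
    unfolding in_closure_of
  proof (intro conjI allI impI)
    show "y \<in> topspace mtopology" using yM by simp
    fix E assume "y \<in> E \<and> openin mtopology E"
    then obtain r where r: "r > 0" "mball y r \<subseteq> E"
      unfolding openin_mtopology by metis
    obtain k where k: "1 / real (Suc k) < r"
      using r(1) nat_approx_posE by metis
    obtain n where n: "n \<in> A" "n > k"
      using AB(3) by (meson infinite_nat_iff_unbounded)
    then obtain z where z: "z \<in> R n" using AB(1) unfolding N_def by auto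
    have "z \<in> mcball y (1 / real (Suc k))" using near[OF n(2)] z by auto
    then have "z \<in> E" using k r(2) by auto
    moreover have "z \<in> T" unfolding T_alt using n(1) AB(5) z by auto
    ultimately show "\<exists>z. z \<in> T \<and> z \<in> E" by auto
  qed
  moreover have "T \<subseteq> mtopology closure_of T"
    using diiT by (intro closure_of_subset dense_in_itself_subset_topspace)
  ultimately have diiP0: "dense_in_itself mtopology P0"
    unfolding P0_T by (intro dense_in_itself_between_closure[OF diiT]) auto
  have "fsigma_in mtopology (D n - {y})" for n
    using D(2) \<open>closedin mtopology {y}\<close>
    by (intro fsigma_in_diff closed_imp_gdelta_in metrizable_space_mtopology)
  then have "gdelta_in mtopology P0"
    unfolding P0_def by (intro gdelta_in_diff gd fsigma_in_Union) auto
  then have perfP0: "perfect_gdelta mtopology P0"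
    using diiP0 yP0 by (auto simp: perfect_gdelta_def)
  have perfR: "perfect_gdelta mtopology (R n)" if "n \<in> B" for n
    using that AB(2) D(1,5) gdY' unfolding perfect_gdelta_def R_def N_def by (auto intro: gdelta_in_Int)
  define \<P> where "\<P> = insert P0 (R ` B)"
  show thesis
  proof
    show "gdelta_partition mtopology Y \<P>"
      unfolding gdelta_partition_def
    proof (intro conjI)
      have RY: "R n \<subseteq> Y" for n unfolding R_def Y'_eq by auto
      have P0R: "P0 \<inter> R n = {}" if "n \<in> B" for n
        unfolding P0_alt using that by auto
      show "partition_on Y \<P>"
      proof (rule partition_onI)
        show "\<Union>\<P> = Y" unfolding \<P>_def P0_alt using RY by auto
        show "{} \<notin> \<P>"
          using perfP0 perfR by (auto simp: \<P>_def perfect_gdelta_def)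
        show "disjnt S S'" if S: "S \<in> \<P>" "S' \<in> \<P>" "S \<noteq> S'" for S S'
        proof -
          consider "S = P0" "S' \<in> R ` B" | "S' = P0" "S \<in> R ` B" | "S \<in> R ` B" "S' \<in> R ` B"
            using S unfolding \<P>_def by (metis insertE)
          then show ?thesis
          proof cases
            case 3
            then obtain m n where "S = R m" "S' = R n" by (metis imageE)
            with S(3) disjR[of m n] show ?thesis by (auto simp: disjnt_def)
          qed (use P0R in \<open>auto simp: disjnt_def\<close>)
        qed
      qed
      show "countable \<P>" by (simp add: \<P>_def)
      show "\<forall>P\<in>\<P>. perfect_gdelta mtopology P"
        using perfP0 perfR by (auto simp: \<P>_def)
    qed
    have "inj_on R B"
      using disjR AB(2) unfolding inj_on_def N_def by (metis (mono_tags) Int_absorb mem_Collect_eq subsetD)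
    then show "infinite \<P>"
      unfolding \<P>_def using AB(4) by (simp add: finite_image_iff)
  qed
qed

text \<open>
  The closures of the pieces are kept inside an open set, so that limits of branches of the scheme
  cannot leave the \<open>G\<^sub>\<delta>\<close> sets attached to its nodes.
\<close>

lemma (in Metric_space) small_gdelta_partition:
  assumes sc: "second_countable mtopology" and Y: "perfect_gdelta mtopology Y"
    and V: "openin mtopology V" "Y \<subseteq> V" and "\<epsilon> > 0"
  obtains \<P> where "gdelta_partition mtopology Y \<P>"
    "\<And>P. P \<in> \<P> \<Longrightarrow> mtopology closure_of P \<subseteq> V"
    "\<And>P. P \<in> \<P> \<Longrightarrow> \<exists>c. mtopology closure_of P \<subseteq> mcball c \<epsilon>"
proof -
  obtain \<B> where \<B>: "countable \<B>" "\<And>b. b \<in> \<B> \<Longrightarrow> openin mtopology b"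
    "\<And>U x. openin mtopology U \<Longrightarrow> x \<in> U \<Longrightarrow> \<exists>b\<in>\<B>. x \<in> b \<and> b \<subseteq> U"
    using sc unfolding second_countable_def by metis
  define \<C> where "\<C> = {b \<in> \<B>. mtopology closure_of b \<subseteq> V \<and> (\<exists>c. mtopology closure_of b \<subseteq> mcball c \<epsilon>)}"
  have YM: "Y \<subseteq> M" and dii: "dense_in_itself mtopology Y" and gd: "gdelta_in mtopology Y"
    using Y dense_in_itself_subset_topspace[of mtopology Y] by (auto simp: perfect_gdelta_def)
  have cov: "Y \<subseteq> \<Union>\<C>"
  proof
    fix y assume y: "y \<in> Y"
    then obtain r where r: "r > 0" "mball y r \<subseteq> V"
      using V unfolding openin_mtopology by (metis subsetD)
    define s where "s = min (r/2) \<epsilon>"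
    have s: "s > 0" "s < r" "s \<le> \<epsilon>" using r(1) \<open>\<epsilon> > 0\<close> by (auto simp: s_def)
    have "y \<in> mball y s" using y YM s by auto
    then obtain b where b: "b \<in> \<B>" "y \<in> b" "b \<subseteq> mball y s"
      using \<B>(3)[OF openin_mball] by metis
    have "mtopology closure_of b \<subseteq> mcball y s"
      using b(3) mball_subset_mcball by (intro closure_of_minimal) auto
    moreover have "mcball y s \<subseteq> V" "mcball y s \<subseteq> mcball y \<epsilon>"
      using s r(2) by auto
    ultimately have "b \<in> \<C>"
      unfolding \<C>_def using b(1) by (blast intro: order_trans)
    with b(2) show "y \<in> \<Union>\<C>" by auto
  qed
  have ne: "\<C> \<noteq> {}" using cov Y by (auto simp: perfect_gdelta_def)
  have cC: "countable \<C>" using \<B>(1) by (auto simp: \<C>_def)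
  define U where "U = from_nat_into \<C>"
  have rU: "range U = \<C>" unfolding U_def using ne cC by (rule range_from_nat_into)
  have U: "U n \<in> \<C>" for n using rU by auto
  have openU: "openin mtopology (U n)" for n using U[of n] \<B>(2) by (auto simp: \<C>_def)
  have cov': "Y \<subseteq> (\<Union>n. U n)" using cov rU by simp
  obtain D where D: "\<And>n. gdelta_in mtopology (D n)"
    "disjoint_family D" "Y \<subseteq> (\<Union>n. D n)"
    "\<And>n. dense_in_itself mtopology (Y \<inter> D n)"
    "\<And>n. D n \<subseteq> mtopology closure_of U n"
    using subordinate_partition[OF metrizable_space_mtopology dii openU cov'] by metis
  define \<P> where "\<P> = range (\<lambda>n. Y \<inter> D n) - {{}}"
  have cl: "mtopology closure_of (Y \<inter> D n) \<subseteq> mtopology closure_of U n" for n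
    using D(5)[of n] by (intro closure_of_minimal) auto
  show thesis
  proof
    show "gdelta_partition mtopology Y \<P>"
      unfolding gdelta_partition_def
    proof (intro conjI)
      show "partition_on Y \<P>"
      proof (rule partition_onI)
        have "\<Union>\<P> = (\<Union>n. Y \<inter> D n)" unfolding \<P>_def by blast
        then show "\<Union>\<P> = Y" using D(3) by auto
        show "{} \<notin> \<P>" by (simp add: \<P>_def)
        show "disjnt S S'" if S: "S \<in> \<P>" "S' \<in> \<P>" "S \<noteq> S'" for S S'
        proof -
          obtain m n where mn: "S = Y \<inter> D m" "S' = Y \<inter> D n"
            using S(1,2) by (auto simp: \<P>_def)
          with S(3) have "m \<noteq> n" by auto
          then have "D m \<inter> D n = {}"
            using D(2) by (auto simp: disjoint_family_on_def)
          then show ?thesis unfolding mn disjnt_def by auto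
        qed
      qed
      show "countable \<P>" by (simp add: \<P>_def)
      show "\<forall>P\<in>\<P>. perfect_gdelta mtopology P"
        using D(1,4) gd unfolding \<P>_def perfect_gdelta_def by (auto intro: gdelta_in_Int)
    qed
    show "mtopology closure_of P \<subseteq> V" if P: "P \<in> \<P>" for P
    proof -
      obtain n where "P = Y \<inter> D n" using P by (auto simp: \<P>_def)
      then show ?thesis using cl[of n] U[of n] by (auto simp: \<C>_def)
    qed
    show "\<exists>c. mtopology closure_of P \<subseteq> mcball c \<epsilon>" if P: "P \<in> \<P>" for P
    proof -
      obtain n where "P = Y \<inter> D n" using P by (auto simp: \<P>_def)
      then show ?thesis using cl[of n] U[of n] unfolding \<C>_def by (auto intro: order_trans)
    qed
  qed
qed

text \<open>
  If \<open>Y \<inter> Q\<close> contains a nonempty set \<open>Z\<close> that is dense in itself, its closure in \<open>Y\<close> still lies in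
  \<open>Q\<close> and splits \<open>Y\<close> into two admissible parts: a relatively closed one that is dense in itself, and
  a relatively open one. Cutting these further, first into infinitely many and then into small pieces,
  leaves at least one piece inside \<open>Q\<close>.
\<close>

lemma (in Metric_space) branching_gdelta_partition:
  assumes sc: "second_countable mtopology" and Y: "perfect_gdelta mtopology Y"
    and V: "openin mtopology V" "Y \<subseteq> V" and "\<epsilon> > 0" and Q: "closedin mtopology Q"
  obtains P :: "nat \<Rightarrow> 'a set" where "\<And>i. perfect_gdelta mtopology (P i)"
    "disjoint_family P" "(\<Union>i. P i) = Y"
    "\<And>i. mtopology closure_of P i \<subseteq> V"
    "\<And>i. \<exists>c. mtopology closure_of P i \<subseteq> mcball c \<epsilon>"
    "\<And>Z. Z \<subseteq> Y \<inter> Q \<Longrightarrow> Z \<noteq> {} \<Longrightarrow> dense_in_itself mtopology Z \<Longrightarrow> \<exists>i. P i \<subseteq> Q"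
proof -
  have dii: "dense_in_itself mtopology Y" and gd: "gdelta_in mtopology Y" and YM: "Y \<subseteq> M"
    using Y dense_in_itself_subset_topspace[of mtopology Y] by (auto simp: perfect_gdelta_def)
  obtain \<P>0 where P0: "gdelta_partition mtopology Y \<P>0"
    and P0Q: "\<And>Z. Z \<subseteq> Y \<inter> Q \<Longrightarrow> Z \<noteq> {} \<Longrightarrow> dense_in_itself mtopology Z \<Longrightarrow> \<exists>P\<in>\<P>0. P \<subseteq> Q"
  proof (cases "\<exists>Z. Z \<subseteq> Y \<inter> Q \<and> Z \<noteq> {} \<and> dense_in_itself mtopology Z")
    case False
    have "gdelta_partition mtopology Y {Y}"
      using Y by (auto simp: gdelta_partition_def perfect_gdelta_def partition_on_space)
    with False that show ?thesis by metis
  next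
    case True
    then obtain Z where Z: "Z \<subseteq> Y \<inter> Q" "Z \<noteq> {}" "dense_in_itself mtopology Z" by metis
    define C where "C = mtopology closure_of Z"
    have ZC: "Z \<subseteq> C"
      unfolding C_def using Z(3) by (intro closure_of_subset dense_in_itself_subset_topspace)
    have CQ: "C \<subseteq> Q" unfolding C_def using Z(1) Q by (intro closure_of_minimal) auto
    have clC: "closedin mtopology C" by (simp add: C_def)
    then have "gdelta_in mtopology (Y \<inter> C)"
      by (intro gdelta_in_Int gd closed_imp_gdelta_in metrizable_space_mtopology)
    moreover have "dense_in_itself mtopology (Y \<inter> C)"
      by (rule dense_in_itself_between_closure[OF Z(3)]) (use Z(1) ZC in \<open>auto simp: C_def\<close>)
    ultimately have perf1: "perfect_gdelta mtopology (Y \<inter> C)"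
      using Z(1,2) ZC by (auto simp: perfect_gdelta_def)
    have opC: "openin mtopology (M - C)" using clC by (simp add: closedin_def)
    have eq: "Y - C = Y \<inter> (M - C)" using YM by auto
    have perf2: "perfect_gdelta mtopology (Y - C)" if "Y - C \<noteq> {}"
      unfolding eq using that[unfolded eq] by (intro perfect_gdelta_openin_Int Y opC)
    have "gdelta_partition mtopology Y ({Y \<inter> C, Y - C} - {{}})"
      unfolding gdelta_partition_def partition_on_def disjoint_def
      using perf1 perf2 by auto
    moreover have "Y \<inter> C \<in> {Y \<inter> C, Y - C} - {{}}"
      using perf1 by (simp add: perfect_gdelta_def)
    ultimately show ?thesis using that CQ by (metis inf.coboundedI2)
  qed
  have "\<exists>\<P>. gdelta_partition mtopology S \<P> \<and> infinite \<P>" if "S \<in> \<P>0" for S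
    using infinite_gdelta_partition[of S] P0 that unfolding gdelta_partition_def by metis
  then obtain I where I: "\<And>S. S \<in> \<P>0 \<Longrightarrow> gdelta_partition mtopology S (I S)"
    "\<And>S. S \<in> \<P>0 \<Longrightarrow> infinite (I S)"
    by metis
  define \<P>1 where "\<P>1 = (\<Union>S\<in>\<P>0. I S)"
  have P1: "gdelta_partition mtopology Y \<P>1"
    unfolding \<P>1_def using P0 I(1) by (rule gdelta_partition_refine)
  have "\<P>0 \<noteq> {}" using P0 Y by (auto simp: gdelta_partition_def partition_on_def perfect_gdelta_def)
  then have inf1: "infinite \<P>1"
    unfolding \<P>1_def using I(2) by (meson UN_upper ex_in_conv finite_subset)
  have "\<exists>\<P>. gdelta_partition mtopology S \<P> \<and>
      (\<forall>P\<in>\<P>. mtopology closure_of P \<subseteq> V \<and> (\<exists>c. mtopology closure_of P \<subseteq> mcball c \<epsilon>))"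
    if "S \<in> \<P>1" for S
  proof -
    have "perfect_gdelta mtopology S" "S \<subseteq> V"
      using P1 that V(2) by (auto simp: gdelta_partition_def partition_on_def)
    then show ?thesis
      using small_gdelta_partition[OF sc _ V(1) _ \<open>\<epsilon> > 0\<close>, of S] by metis
  qed
  then obtain J where J: "\<And>S. S \<in> \<P>1 \<Longrightarrow> gdelta_partition mtopology S (J S)"
    "\<And>S P. S \<in> \<P>1 \<Longrightarrow> P \<in> J S \<Longrightarrow> mtopology closure_of P \<subseteq> V"
    "\<And>S P. S \<in> \<P>1 \<Longrightarrow> P \<in> J S \<Longrightarrow> \<exists>c. mtopology closure_of P \<subseteq> mcball c \<epsilon>"
    by metis
  define \<P> where "\<P> = (\<Union>S\<in>\<P>1. J S)"
  have P: "gdelta_partition mtopology Y \<P>"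
    unfolding \<P>_def using P1 J(1) by (rule gdelta_partition_refine)
  have inf: "infinite \<P>"
    unfolding \<P>_def using P1 J(1) inf1 by (rule gdelta_partition_refine)
  have part: "\<Union>\<P> = Y" "disjoint \<P>" "countable \<P>" "\<And>S. S \<in> \<P> \<Longrightarrow> perfect_gdelta mtopology S"
    using P by (auto simp: gdelta_partition_def partition_on_def)
  have bij: "bij_betw (from_nat_into \<P>) UNIV \<P>"
    using part(3) inf by (rule bij_betw_from_nat_into)
  then have in_P: "from_nat_into \<P> i \<in> \<P>" for i by (auto simp: bij_betw_def)
  have refines: "\<exists>P'\<in>(\<Union>S\<in>\<Q>. K S). P' \<subseteq> P"
    if "P \<in> \<Q>" "gdelta_partition mtopology Y \<Q>" "gdelta_partition mtopology P (K P)" for P \<Q> K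
  proof -
    have "\<Union>(K P) = P" "P \<noteq> {}"
      using that by (auto simp: gdelta_partition_def perfect_gdelta_def partition_on_def)
    then obtain P' where "P' \<in> K P" "P' \<subseteq> P" by blast
    with that(1) show ?thesis by blast
  qed
  show thesis
  proof
    show "perfect_gdelta mtopology (from_nat_into \<P> i)" for i
      using part(4) in_P by metis
    show "disjoint_family (from_nat_into \<P>)"
      unfolding disjoint_family_on_def
      using part(2) in_P bij unfolding disjoint_def bij_betw_def inj_on_def by metis
    show "(\<Union>i. from_nat_into \<P> i) = Y"
      using part(1) bij unfolding bij_betw_def by simp
    show "mtopology closure_of from_nat_into \<P> i \<subseteq> V" for i
      using in_P[of i] J(2) by (auto simp: \<P>_def)
    show "\<exists>c. mtopology closure_of from_nat_into \<P> i \<subseteq> mcball c \<epsilon>" for i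
      using in_P[of i] J(3) unfolding \<P>_def by (metis UN_E)
    show "\<exists>i. from_nat_into \<P> i \<subseteq> Q"
      if Z: "Z \<subseteq> Y \<inter> Q" "Z \<noteq> {}" "dense_in_itself mtopology Z" for Z
    proof -
      obtain S where S: "S \<in> \<P>0" "S \<subseteq> Q" using P0Q[OF Z] by metis
      obtain S1 where S1: "S1 \<in> \<P>1" "S1 \<subseteq> S"
        unfolding \<P>1_def using refines[of S \<P>0 I, OF S(1) P0 I(1)[OF S(1)]] by metis
      obtain S2 where S2: "S2 \<in> \<P>" "S2 \<subseteq> S1"
        unfolding \<P>_def using refines[of S1 \<P>1 J, OF S1(1) P1 J(1)[OF S1(1)]] by metis
      obtain i where "S2 = from_nat_into \<P> i"
        using S2(1) bij unfolding bij_betw_def by (metis imageE)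
      with S2 S1 S show ?thesis by blast
    qed
  qed
qed

section \<open>Lusin schemes indexed by finite sequences\<close>

text \<open>
  Initial segments are stored in reverse, most recent entry first: extending a branch by one step
  is then a \<open>Cons\<close>, and schemes can be defined by primitive recursion on lists.
\<close>

primrec rprefix :: "(nat \<Rightarrow> nat) \<Rightarrow> nat \<Rightarrow> nat list" where
  "rprefix x 0 = []"
| "rprefix x (Suc n) = x n # rprefix x n"

lemma rprefix_eq_iff: "rprefix x n = rprefix y n \<longleftrightarrow> (\<forall>i<n. x i = y i)"
  by (induction n) (auto simp: less_Suc_eq)

lemma length_rprefix [simp]: "length (rprefix x n) = n"
  by (induction n) auto

lemma ex_rprefix: "\<exists>x. rprefix x (length s) = s"
proof (induction s)
  case (Cons a s)
  then obtain x where "rprefix x (length s) = s" by auto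
  moreover have "rprefix (x(length s := a)) (length s) = rprefix x (length s)"
    by (simp add: rprefix_eq_iff)
  ultimately show ?case
    by (intro exI[of _ "x(length s := a)"]) (simp add: fun_upd_same del: fun_upd_apply)
qed auto

definition cylinder :: "nat list \<Rightarrow> (nat \<Rightarrow> nat) set"
  where "cylinder s = {x. rprefix x (length s) = s}"

lemma cylinder_rprefix: "cylinder (rprefix x n) = {y. \<forall>i<n. y i = x i}"
  by (auto simp: cylinder_def rprefix_eq_iff)

lemma rprefix_cases:
  obtains x where "s = rprefix x (length s)"
proof -
  obtain x where "rprefix x (length s) = s" using ex_rprefix[of s] by auto
  then show thesis by (rule that[OF sym])
qed

lemma cylinder_nonempty: "cylinder s \<noteq> {}"
  using ex_rprefix[of s] by (auto simp: cylinder_def)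

lemma openin_cylinder: "openin baire_space (cylinder s)"
proof -
  obtain x where x: "s = rprefix x (length s)" by (rule rprefix_cases)
  define U where "U i = (if i < length s then {x i} else UNIV)" for i
  have "cylinder s = Pi\<^sub>E UNIV U"
    by (subst x, unfold cylinder_rprefix) (auto simp: U_def PiE_UNIV_domain split: if_splits)
  moreover have "finite {i. U i \<noteq> UNIV}"
    by (rule finite_subset[of _ "{..<length s}"]) (auto simp: U_def)
  ultimately show ?thesis
    unfolding baire_space_def by (simp add: openin_PiE_gen)
qed

lemma openin_baire_space_contains_cylinder:
  assumes "openin baire_space U" "x \<in> U"
  obtains n where "cylinder (rprefix x n) \<subseteq> U"
proof -
  obtain W where W: "finite {i. W i \<noteq> UNIV}" "x \<in> Pi\<^sub>E UNIV W" "Pi\<^sub>E UNIV W \<subseteq> U"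
    using assms unfolding baire_space_def openin_product_topology_alt by auto
  obtain n where n: "\<And>i. W i \<noteq> UNIV \<Longrightarrow> i < n"
    using W(1) unfolding finite_nat_set_iff_bounded by auto
  have "cylinder (rprefix x n) \<subseteq> Pi\<^sub>E UNIV W"
  proof
    fix y assume "y \<in> cylinder (rprefix x n)"
    then have "\<And>i. i < n \<Longrightarrow> y i = x i" by (simp add: cylinder_def rprefix_eq_iff)
    then have "y i \<in> W i" for i
      using W(2) n[of i] unfolding PiE_UNIV_domain by (cases "W i = UNIV") auto
    then show "y \<in> Pi\<^sub>E UNIV W" by auto
  qed
  then show thesis by (rule that[OF order_trans[OF _ W(3)]])
qed

lemma no_isolated_points_baire_space:
  assumes "openin baire_space U" "x \<in> U"
  obtains y where "y \<in> U" "y \<noteq> x"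
proof -
  obtain n where n: "cylinder (rprefix x n) \<subseteq> U"
    using openin_baire_space_contains_cylinder assms by metis
  define y where "y = x(n := Suc (x n))"
  have "y \<in> cylinder (rprefix x n)"
    by (simp add: cylinder_def rprefix_eq_iff y_def)
  with n have "y \<in> U" by (rule subsetD)
  moreover have "y \<noteq> x"
    by (auto simp: fun_eq_iff y_def)
  ultimately show thesis by (rule that)
qed

text \<open>
  A point of \<open>X\<close> lies in exactly one set of each level, hence determines a branch; conversely every
  branch is inhabited, and by exactly one point, since the sets along it shrink to that point.
  Matching branches with points is the desired bijection, and the sets of the scheme correspond to
  the basic open sets of the Baire space.
\<close>

lemma continuous_bijection_from_scheme:
  fixes T :: "nat list \<Rightarrow> 'a set"
  assumes "t1_space X" and root: "T [] = topspace X"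
    and children: "\<And>s. T s = (\<Union>i. T (i # s))"
    and disj: "\<And>s. disjoint_family (\<lambda>i. T (i # s))"
    and inhabited: "\<And>x. \<exists>p. \<forall>n. p \<in> T (rprefix x n)"
    and small: "\<And>x p U. \<forall>n. p \<in> T (rprefix x n) \<Longrightarrow> openin X U \<Longrightarrow> p \<in> U \<Longrightarrow>
      \<exists>n. T (rprefix x n) \<subseteq> U"
  obtains f where "continuous_map baire_space X f" "bij_betw f UNIV (topspace X)"
    "\<And>s. f -` T s = cylinder s"
proof -
  obtain f where f: "\<And>x n. f x \<in> T (rprefix x n)"
    using inhabited by metis
  have f_top: "f x \<in> topspace X" for x using f[of x 0] root by simp
  have unique: "x = y" if "\<And>n. p \<in> T (rprefix x n)" "\<And>n. p \<in> T (rprefix y n)" for x y p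
  proof -
    have "rprefix x n = rprefix y n" for n
    proof (induction n)
      case (Suc n)
      have "p \<in> T (x n # rprefix x n)" "p \<in> T (y n # rprefix x n)"
        using that[of "Suc n"] Suc by auto
      then have "x n = y n"
        using disj[of "rprefix x n"] unfolding disjoint_family_on_def by blast
      with Suc show ?case by simp
    qed auto
    then have "x n = y n" for n
      by (metis lessI rprefix_eq_iff)
    then show ?thesis by auto
  qed
  \<comment> \<open>Every point of a node lies on a branch through that node: follow its children downwards.\<close>
  have branch: "\<exists>x. rprefix x (length s) = s \<and> (\<forall>n. p \<in> T (rprefix x n))" if p: "p \<in> T s" for p s
  proof -
    have ex: "\<exists>i. p \<in> T (i # t)" if "p \<in> T t" for t
      using that children[of t] by blast
    define g where "g t = (SOME i. p \<in> T (i # t))" for t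
    have g: "p \<in> T (g t # t)" if "p \<in> T t" for t
      unfolding g_def using ex[OF that] by (rule someI_ex)
    define L where "L n = ((\<lambda>t. g t # t) ^^ n) s" for n
    obtain y where y: "rprefix y (length s) = s" using ex_rprefix[of s] by auto
    define x where "x n = (if n < length s then y n else g (L (n - length s)))" for n
    have xs: "rprefix x (length s) = s"
      by (subst (2) y[symmetric]) (simp add: rprefix_eq_iff x_def)
    have L: "rprefix x (length s + n) = L n \<and> p \<in> T (L n)" for n
    proof (induction n)
      case 0
      then show ?case using xs p by (simp add: L_def)
    next
      case (Suc n)
      have "L (Suc n) = g (L n) # L n" by (simp add: L_def)
      moreover have "x (length s + n) = g (L n)" by (simp add: x_def)
      ultimately show ?case using Suc g by simp
    qed
    have up: "p \<in> T (rprefix x n)" if "p \<in> T (rprefix x (Suc n))" for n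
      using that children[of "rprefix x n"] by auto
    have "p \<in> T (rprefix x n)" for n
    proof (cases "length s \<le> n")
      case True
      then show ?thesis using L[of "n - length s"] by simp
    next
      case False
      then have "n \<le> length s" by simp
      then show ?thesis
        by (induction rule: inc_induct) (use xs p up in auto)
    qed
    with xs show ?thesis by metis
  qed
  have only: "f x = p" if p: "\<And>n. p \<in> T (rprefix x n)" for x p
  proof (rule ccontr)
    assume ne: "f x \<noteq> p"
    have ptop: "p \<in> topspace X" using p[of 0] root by simp
    have "openin X (topspace X - {f x})"
      using assms(1) f_top[of x] by (simp add: closedin_t1_singleton openin_diff)
    then obtain n where "T (rprefix x n) \<subseteq> topspace X - {f x}"
      using small[of p x "topspace X - {f x}"] p ne ptop by auto
    with f[of x n] show False by auto
  qed
  show thesis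
  proof
    show "bij_betw f UNIV (topspace X)"
      unfolding bij_betw_def
    proof
      show "inj f"
      proof (rule injI)
        fix x y assume "f x = f y"
        then show "x = y" using unique[of "f x" x y] f[of x] f[of y] by simp
      qed
      show "range f = topspace X"
      proof
        show "range f \<subseteq> topspace X" using f_top by auto
        show "topspace X \<subseteq> range f"
        proof
          fix p assume "p \<in> topspace X"
          then obtain x where "\<And>n. p \<in> T (rprefix x n)" using branch[of p "[]"] root by auto
          then show "p \<in> range f" using only by (metis rangeI)
        qed
      qed
    qed
    show fT: "f -` T s = cylinder s" for s
    proof
      show "cylinder s \<subseteq> f -` T s"
        unfolding cylinder_def using f by (metis (mono_tags) mem_Collect_eq subsetI vimageI)
      show "f -` T s \<subseteq> cylinder s"
      proof
        fix x assume "x \<in> f -` T s"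
        then obtain y where y: "rprefix y (length s) = s" "\<And>n. f x \<in> T (rprefix y n)"
          using branch[of "f x" s] by auto
        have "x = y" using unique[of "f x" x y] f y by auto
        with y show "x \<in> cylinder s" by (simp add: cylinder_def)
      qed
    qed
    show "continuous_map baire_space X f"
      unfolding continuous_map_def
    proof (intro conjI allI impI)
      show "f \<in> topspace baire_space \<rightarrow> topspace X" using f_top by auto
      fix U assume U: "openin X U"
      show "openin baire_space {x \<in> topspace baire_space. f x \<in> U}"
      proof (subst openin_subopen, intro ballI)
        fix x assume "x \<in> {x \<in> topspace baire_space. f x \<in> U}"
        then obtain n where n: "T (rprefix x n) \<subseteq> U"
          using small[of "f x" x U] f U by auto
        have "cylinder (rprefix x n) \<subseteq> {x \<in> topspace baire_space. f x \<in> U}"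
          using n fT[of "rprefix x n"] by auto
        moreover have "x \<in> cylinder (rprefix x n)" by (simp add: cylinder_def)
        ultimately show "\<exists>W. openin baire_space W \<and> x \<in> W \<and> W \<subseteq> {x \<in> topspace baire_space. f x \<in> U}"
          using openin_cylinder by metis
      qed
    qed
  qed
qed

section \<open>A continuous bijection adapted to countably many closed sets\<close>

lemma (in Metric_space) separable_imp_second_countable:
  assumes "separable_space mtopology"
  shows "second_countable mtopology"
proof -
  obtain C where C: "countable C" "C \<subseteq> M" "mtopology closure_of C = M"
    using assms unfolding separable_space_def by auto
  define \<B> where "\<B> = (\<lambda>(c, n). mball c (1 / real (Suc n))) ` (C \<times> UNIV)"
  show ?thesis
    unfolding second_countable_def
  proof (intro exI conjI allI impI ballI)
    show "countable \<B>" unfolding \<B>_def using C(1) by (intro countable_image countable_SIGMA) auto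
    show "openin mtopology V" if "V \<in> \<B>" for V
      using that by (auto simp: \<B>_def)
    fix U x assume Ux: "openin mtopology U \<and> x \<in> U"
    then obtain r where r: "r > 0" "mball x r \<subseteq> U"
      unfolding openin_mtopology by auto
    have xM: "x \<in> M" using Ux openin_subset by fastforce
    obtain n where n: "1 / real (Suc n) < r / 2"
      using r(1) nat_approx_posE[of "r / 2"] by auto
    have "x \<in> mball x (1 / real (Suc n))" using xM by simp
    then obtain c where c: "c \<in> C" "c \<in> mball x (1 / real (Suc n))"
      using C(3) xM openin_mball unfolding closure_of_def by blast
    have "mball c (1 / real (Suc n)) \<subseteq> mball x r"
    proof
      fix z assume z: "z \<in> mball c (1 / real (Suc n))"
      then have "d x z \<le> d x c + d c z" using c(2) by (intro triangle) auto
      with z c(2) n show "z \<in> mball x r" by auto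
    qed
    moreover have "x \<in> mball c (1 / real (Suc n))" using c(2) by (auto simp: commute)
    moreover have "mball c (1 / real (Suc n)) \<in> \<B>" using c(1) by (auto simp: \<B>_def)
    ultimately show "\<exists>V\<in>\<B>. x \<in> V \<and> V \<subseteq> U" using r(2) by (meson order_trans)
  qed
qed

lemma perfect_polish_space_second_countable:
  assumes "perfect_polish_space X"
  shows "second_countable X"
  using assms Metric_space.separable_imp_second_countable
  unfolding perfect_polish_space_def completely_metrizable_space_def by metis

text \<open>
  The form in which the branching is iterated. Each set carries a sequence of open sets \<open>G\<close>
  exhibiting it as \<open>G\<^sub>\<delta>\<close>, and the sequences of the children are refinements of it. Keeping the closures
  of the children inside an initial segment of this sequence, of a length that grows along the
  branch, will force a limit point of the branch into all the open sets.
\<close>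

lemma (in Metric_space) branching_gdelta_partition_with_witnesses:
  assumes sc: "second_countable mtopology" and Y: "perfect_gdelta mtopology Y"
    and G: "\<And>n. openin mtopology (G n)" "(\<Inter>n. G n) = Y"
    and "\<epsilon> > 0" and Q: "closedin mtopology Q"
  obtains P :: "nat \<Rightarrow> 'a set" and H :: "nat \<Rightarrow> nat \<Rightarrow> 'a set"
  where "\<And>i. perfect_gdelta mtopology (P i)" "\<And>i n. openin mtopology (H i n)"
    "\<And>i. (\<Inter>n. H i n) = P i" "\<And>i n. H i n \<subseteq> G n"
    "disjoint_family P" "(\<Union>i. P i) = Y"
    "\<And>i n. n \<le> m \<Longrightarrow> mtopology closure_of P i \<subseteq> G n"
    "\<And>i. \<exists>c. mtopology closure_of P i \<subseteq> mcball c \<epsilon>"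
    "\<And>Z. Z \<subseteq> Y \<inter> Q \<Longrightarrow> Z \<noteq> {} \<Longrightarrow> dense_in_itself mtopology Z \<Longrightarrow> \<exists>i. P i \<subseteq> Q"
proof -
  define V where "V = (\<Inter>n\<in>{..m}. G n)"
  have "openin mtopology V" unfolding V_def using G(1) by (intro openin_INT2) auto
  moreover have "Y \<subseteq> V" unfolding V_def using G(2) by auto
  ultimately obtain P :: "nat \<Rightarrow> 'a set" where P: "\<And>i. perfect_gdelta mtopology (P i)"
    "disjoint_family P" "(\<Union>i. P i) = Y"
    "\<And>i. mtopology closure_of P i \<subseteq> V"
    "\<And>i. \<exists>c. mtopology closure_of P i \<subseteq> mcball c \<epsilon>"
    "\<And>Z. Z \<subseteq> Y \<inter> Q \<Longrightarrow> Z \<noteq> {} \<Longrightarrow> dense_in_itself mtopology Z \<Longrightarrow> \<exists>i. P i \<subseteq> Q"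
    using branching_gdelta_partition[OF sc Y _ _ \<open>\<epsilon> > 0\<close> Q] by metis
  have "\<exists>C :: nat \<Rightarrow> 'a set. (\<forall>n. openin mtopology (C n)) \<and> (\<Inter>n. C n) = P i" for i
    using P(1)[of i] unfolding perfect_gdelta_def gdelta_in_descending by metis
  then obtain C :: "nat \<Rightarrow> nat \<Rightarrow> 'a set" where C: "\<And>i n. openin mtopology (C i n)" "\<And>i. (\<Inter>n. C i n) = P i"
    by metis
  show thesis
  proof (rule that[of P "\<lambda>i n. C i n \<inter> G n"])
    show "(\<Inter>n. C i n \<inter> G n) = P i" for i
      using C(2)[of i] G(2) P(3) by auto
    show "mtopology closure_of P i \<subseteq> G n" if "n \<le> m" for i n
      using P(4)[of i] that unfolding V_def by auto
  qed (use P C(1) G(1) in auto)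
qed

text \<open>
  A Lusin scheme is built by repeated branching, where the sets on level \<open>k\<close> are split with respect to
  \<open>Q k\<close>. The countably many sets \<open>T s\<close> of level \<open>k\<close> cover \<open>Q k\<close>, so by the Baire category theorem
  one of them is dense in a nonempty relatively open part of \<open>Q k\<close>. There \<open>T s \<inter> Q k\<close> contains a
  nonempty set that is dense in itself, so some child of \<open>T s\<close> is contained in \<open>Q k\<close>, and
  the preimage of this child is a cylinder.
\<close>

lemma continuous_bijection_with_fat_preimages:
  fixes Q :: "nat \<Rightarrow> 'a set"
  assumes X: "completely_metrizable_space X" "second_countable X"
    "topspace X \<noteq> {}" "dense_in_itself X (topspace X)"
    and Q: "\<And>k. closedin X (Q k)" "\<And>k. dense_in_itself X (Q k)"
  obtains f where "continuous_map baire_space X f" "bij_betw f UNIV (topspace X)"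
    "\<And>k. Q k \<noteq> {} \<Longrightarrow> \<exists>s. cylinder s \<subseteq> f -` Q k"
proof -
  obtain M d where "Metric_space M d" and complete: "Metric_space.mcomplete M d"
    and Xeq: "X = Metric_space.mtopology M d"
    using X(1) unfolding completely_metrizable_space_def by metis
  interpret Metric_space M d by fact
  have topX: "topspace X = M" by (simp add: Xeq)
  have t1: "t1_space X" by (simp add: Xeq t1_space_mtopology)
  define valid where "valid st \<longleftrightarrow> perfect_gdelta X (fst st) \<and> (\<forall>n. openin X (snd st n)) \<and>
    (\<Inter>n. snd st n) = fst st" for st :: "'a set \<times> (nat \<Rightarrow> 'a set)"
  define splits where "splits m st c \<longleftrightarrow>
      (\<forall>i. valid (c i)) \<and> (\<forall>i n. snd (c i) n \<subseteq> snd st n) \<and>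
      disjoint_family (\<lambda>i. fst (c i)) \<and> (\<Union>i. fst (c i)) = fst st \<and>
      (\<forall>i n. n \<le> m \<longrightarrow> X closure_of fst (c i) \<subseteq> snd st n) \<and>
      (\<forall>i. \<exists>a. X closure_of fst (c i) \<subseteq> mcball a (1 / real (Suc m))) \<and>
      (\<forall>Z. Z \<subseteq> fst st \<inter> Q m \<longrightarrow> Z \<noteq> {} \<longrightarrow> dense_in_itself X Z \<longrightarrow> (\<exists>i. fst (c i) \<subseteq> Q m))"
    for m and st :: "'a set \<times> (nat \<Rightarrow> 'a set)" and c :: "nat \<Rightarrow> 'a set \<times> (nat \<Rightarrow> 'a set)"
  have "\<exists>c. splits m st c" if valid: "valid st" for m st
  proof -
    have st: "perfect_gdelta mtopology (fst st)" "\<And>n. openin mtopology (snd st n)"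
      "(\<Inter>n. snd st n) = fst st"
      using valid by (auto simp: valid_def Xeq)
    obtain P :: "nat \<Rightarrow> 'a set" and H :: "nat \<Rightarrow> nat \<Rightarrow> 'a set"
      where "\<And>i. perfect_gdelta mtopology (P i)" "\<And>i n. openin mtopology (H i n)"
        "\<And>i. (\<Inter>n. H i n) = P i" "\<And>i n. H i n \<subseteq> snd st n"
        "disjoint_family P" "(\<Union>i. P i) = fst st"
        "\<And>i n. n \<le> m \<Longrightarrow> mtopology closure_of P i \<subseteq> snd st n"
        "\<And>i. \<exists>c. mtopology closure_of P i \<subseteq> mcball c (1 / real (Suc m))"
        "\<And>Z. Z \<subseteq> fst st \<inter> Q m \<Longrightarrow> Z \<noteq> {} \<Longrightarrow> dense_in_itself mtopology Z \<Longrightarrow> \<exists>i. P i \<subseteq> Q m"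
      using branching_gdelta_partition_with_witnesses
          [OF X(2)[unfolded Xeq] st _ Q(1)[unfolded Xeq], where \<epsilon> = "1 / real (Suc m)" and m = m]
      by (metis of_nat_0_less_iff zero_less_Suc zero_less_divide_1_iff)
    then have "splits m st (\<lambda>i. (P i, H i))"
      unfolding splits_def valid_def Xeq by simp
    then show ?thesis by metis
  qed
  note ex_splits = this
  define c where "c m st = (SOME c. splits m st c)" for m st
  have c: "splits m st (c m st)" if "valid st" for m st
    unfolding c_def using ex_splits[OF that] by (rule someI_ex)
  define node where "node = rec_list (M, \<lambda>_. M) (\<lambda>i s st. c (length s) st i)"
  have node_Nil: "node [] = (M, \<lambda>_. M)"
    and node_Cons: "node (i # s) = c (length s) (node s) i" for i s
    by (simp_all add: node_def)
  have "valid (node s)" for s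
  proof (induction s)
    case Nil
    have "openin X M" using openin_topspace[of X] by (simp only: topX)
    then show ?case using X(3,4) by (auto simp: node_Nil valid_def perfect_gdelta_def topX open_imp_gdelta_in)
  next
    case (Cons i s)
    then show ?case using c[of "node s" "length s"] by (simp add: splits_def node_Cons)
  qed
  then have valid_node: "valid (node s)" and step: "splits (length s) (node s) (\<lambda>i. node (i # s))" for s
    using c by (auto simp: node_Cons)
  define T where "T s = fst (node s)" for s
  define G where "G s = snd (node s)" for s
  have T_perf: "perfect_gdelta X (T s)" and T_G: "(\<Inter>n. G s n) = T s" for s
    using valid_node[of s] by (auto simp: valid_def T_def G_def)
  have T_top: "T s \<subseteq> topspace X" for s
    using T_perf dense_in_itself_subset_topspace by (auto simp: perfect_gdelta_def)
  have T_disj: "disjoint_family (\<lambda>i. T (i # s))" and T_Un: "T s = (\<Union>i. T (i # s))"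
    and G_mono: "G (i # s) n \<subseteq> G s n"
    and T_cl: "n \<le> length s \<Longrightarrow> X closure_of T (i # s) \<subseteq> G s n"
    and T_small: "\<exists>a. X closure_of T (i # s) \<subseteq> mcball a (1 / real (Suc (length s)))"
    and T_Q: "\<lbrakk>Z \<subseteq> T s \<inter> Q (length s); Z \<noteq> {}; dense_in_itself X Z\<rbrakk> \<Longrightarrow> \<exists>i. T (i # s) \<subseteq> Q (length s)"
    for s i n Z
    using step[of s] unfolding splits_def T_def G_def by auto
  have Tx_Suc: "T (rprefix x (Suc n)) \<subseteq> T (rprefix x n)" for x n
    using T_Un[of "rprefix x n"] by auto
  have small: "\<exists>a. X closure_of T (rprefix x (Suc n)) \<subseteq> mcball a (1 / real (Suc n))" for x n
    using T_small[of "x n" "rprefix x n"] by simp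
  have small_dist: "d p q \<le> 2 / real (Suc n)" "p \<in> M" "q \<in> M"
    if pq: "p \<in> T (rprefix x (Suc n))" "q \<in> T (rprefix x (Suc n))" for p q x n
  proof -
    obtain a where a: "X closure_of T (rprefix x (Suc n)) \<subseteq> mcball a (1 / real (Suc n))"
      using small by metis
    have "p \<in> mcball a (1 / real (Suc n))" "q \<in> mcball a (1 / real (Suc n))"
      using a pq closure_of_subset[OF T_top] by (meson subsetD)+
    then show "d p q \<le> 2 / real (Suc n)" "p \<in> M" "q \<in> M"
      using triangle[of p a q] by (auto simp: commute)
  qed
  \<comment> \<open>Completeness gives a limit point \<open>p\<close> of the closures along the branch. 
     Each of the open sets attached to each node of the branch contains some later closure.\<close>
  have inhabited: "\<exists>p. \<forall>n. p \<in> T (rprefix x n)" for x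
  proof -
    define C where "C n = X closure_of T (rprefix x (Suc n))" for n
    have "\<Inter>(range C) \<noteq> {}"
    proof -
      have "closedin mtopology (C n)" for n by (simp add: C_def Xeq)
      moreover have "C n \<noteq> {}" for n
        using T_perf[of "rprefix x (Suc n)"] closure_of_subset[OF T_top, of "rprefix x (Suc n)"]
        unfolding C_def perfect_gdelta_def by auto
      moreover have "decseq C"
        unfolding C_def by (intro decseq_SucI closure_of_mono Tx_Suc)
      moreover have "\<exists>n a. C n \<subseteq> mcball a e" if e: "e > 0" for e
      proof -
        obtain n where n: "1 / real (Suc n) < e" using nat_approx_posE[OF e] by auto
        obtain a where "C n \<subseteq> mcball a (1 / real (Suc n))" unfolding C_def using small by metis
        also have "\<dots> \<subseteq> mcball a e" using n by auto
        finally show ?thesis by metis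
      qed
      ultimately show ?thesis using complete unfolding mcomplete_nest by metis
    qed
    then obtain p where p: "\<And>n. p \<in> C n" by auto
    have Gmono: "G (rprefix x n) k \<subseteq> G (rprefix x j) k" if "j \<le> n" for j n k
      using that
    proof (induction rule: dec_induct)
      case (step m)
      have "G (rprefix x (Suc m)) k \<subseteq> G (rprefix x m) k" using G_mono by simp
      then show ?case using step.IH by (rule order_trans)
    qed simp
    have "p \<in> G (rprefix x j) k" for j k
    proof -
      have "p \<in> C (max j k)" by (rule p)
      also have "\<dots> \<subseteq> G (rprefix x (max j k)) k" unfolding C_def rprefix.simps by (rule T_cl) simp
      also have "\<dots> \<subseteq> G (rprefix x j) k" by (rule Gmono) simp
      finally show ?thesis .
    qed
    then have "p \<in> T (rprefix x j)" for j using T_G[of "rprefix x j"] by auto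
    then show ?thesis by metis
  qed
  have shrink: "\<exists>n. T (rprefix x n) \<subseteq> U"
    if p: "\<forall>n. p \<in> T (rprefix x n)" and U: "openin X U" "p \<in> U" for x p U
  proof -
    obtain r where r: "r > 0" "mball p r \<subseteq> U" using U unfolding Xeq openin_mtopology by metis
    obtain n where n: "1 / real (Suc n) < r / 2"
      using r(1) nat_approx_posE[of "r / 2"] by auto
    have "2 / real (Suc n) = 2 * (1 / real (Suc n))" by simp
    then have r': "2 / real (Suc n) < r" using n by linarith
    have "T (rprefix x (Suc n)) \<subseteq> mball p r"
    proof
      fix q assume q: "q \<in> T (rprefix x (Suc n))"
      show "q \<in> mball p r"
        using small_dist[OF p[rule_format] q] r' by simp
    qed
    with r(2) show ?thesis by (meson order_trans)
  qed
  have T_root: "T [] = topspace X" by (simp add: T_def node_Nil topX)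
  have "\<exists>f. continuous_map baire_space X f \<and> bij_betw f UNIV (topspace X) \<and>
      (\<forall>s. f -` T s = cylinder s)"
    by (rule continuous_bijection_from_scheme[OF t1 T_root T_Un T_disj inhabited])
      (rule shrink, assumption+, metis)
  then obtain f where f: "continuous_map baire_space X f" "bij_betw f UNIV (topspace X)"
    "\<And>s. f -` T s = cylinder s"
    by metis
  have level: "\<exists>s. length s = k \<and> p \<in> T s" if p: "p \<in> topspace X" for p k
  proof -
    obtain x where "p = f x" using f(2) p unfolding bij_betw_def by auto
    then have "p \<in> T (rprefix x k)" using f(3)[of "rprefix x k"] by (auto simp: cylinder_def)
    then show ?thesis using length_rprefix by metis
  qed
  have "\<exists>s. cylinder s \<subseteq> f -` Q k" if ne: "Q k \<noteq> {}" for k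
  proof -
    define S where "S = subtopology X (Q k)"
    have QX: "Q k \<subseteq> topspace X" using Q(1) by (rule closedin_subset)
    have topS: "topspace S = Q k" using QX by (simp add: S_def Int_absorb1)
    \<comment> \<open>One of the countably many sets of level \<open>k\<close> is somewhere dense in \<open>Q k\<close>.\<close>
    have "\<exists>s. length s = k \<and> S interior_of (S closure_of (T s \<inter> Q k)) \<noteq> {}"
    proof (rule ccontr)
      assume neg: "\<nexists>s. length s = k \<and> S interior_of (S closure_of (T s \<inter> Q k)) \<noteq> {}"
      define \<G> where "\<G> = (\<lambda>s. S closure_of (T s \<inter> Q k)) ` {s. length s = k}"
      have "completely_metrizable_space S"
        unfolding S_def using X(1) Q(1) by (rule completely_metrizable_space_closedin)
      moreover have "countable \<G>" unfolding \<G>_def by auto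
      ultimately have "S interior_of \<Union>\<G> = {}"
        using neg by (intro Baire_category_alt) (auto simp: \<G>_def)
      moreover have "\<Union>\<G> = topspace S"
      proof
        show "\<Union>\<G> \<subseteq> topspace S" unfolding \<G>_def using closure_of_subset_topspace by fast
        show "topspace S \<subseteq> \<Union>\<G>"
        proof
          fix p assume "p \<in> topspace S"
          then have p: "p \<in> Q k" "p \<in> topspace X" using topS QX by auto
          then obtain s where s: "length s = k" "p \<in> T s" using level by metis
          have "T s \<inter> Q k \<subseteq> S closure_of (T s \<inter> Q k)"
            by (rule closure_of_subset) (simp add: topS)
          then show "p \<in> \<Union>\<G>" using s p(1) by (auto simp: \<G>_def)
        qed
      qed
      ultimately show False using ne topS interior_of_topspace[of S] by simp
    qed
    then obtain s x where s: "length s = k" and x: "x \<in> S interior_of (S closure_of (T s \<inter> Q k))"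
      by auto
    then obtain W where W: "openin S W" "x \<in> W" "W \<subseteq> S closure_of (T s \<inter> Q k)"
      unfolding interior_of_def by auto
    then obtain E where E: "openin X E" "W = E \<inter> Q k"
      unfolding S_def openin_subtopology by auto
    have cl: "Q k \<inter> E \<subseteq> X closure_of (T s \<inter> Q k)"
      using W(3) E(2) closure_of_subtopology_subset[of X "Q k"] unfolding S_def by blast
    define Z where "Z = E \<inter> (T s \<inter> Q k)"
    have dense: "Q k \<inter> E \<subseteq> X closure_of Z"
      using openin_Int_closure_of_subset[OF E(1), of "T s \<inter> Q k"] cl unfolding Z_def by auto
    have "Z \<noteq> {}" using dense W(2) E(2) by auto
    moreover have "dense_in_itself X Z"
      using t1 dense_in_itself_openin_Int[OF Q(2) E(1)] _ dense
      by (rule dense_in_itself_dense_subset) (auto simp: Z_def)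
    moreover have "Z \<subseteq> T s \<inter> Q (length s)" by (auto simp: Z_def s)
    ultimately obtain i where "T (i # s) \<subseteq> Q k" using T_Q s by metis
    then have "cylinder (i # s) \<subseteq> f -` Q k" using f(3)[of "i # s"] by auto
    then show ?thesis by metis
  qed
  with f(1,2) show thesis by (rule that)
qed

section \<open>The two implications\<close>

lemma not_meager_in_topspace:
  assumes "completely_metrizable_space X" "topspace X \<noteq> {}"
  shows "\<not> meager_in X (topspace X)"
proof
  assume "meager_in X (topspace X)"
  then obtain N :: "nat \<Rightarrow> 'a set" where N: "\<And>n. nowhere_dense_in X (N n)" "topspace X = (\<Union>n. N n)"
    unfolding meager_in_def by metis
  have "X interior_of (\<Union>(range (\<lambda>n. X closure_of N n))) = {}"
    using assms(1) N(1) by (intro Baire_category_alt) (auto simp: nowhere_dense_in_def)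
  moreover have "(\<Union>n. X closure_of N n) = topspace X"
  proof
    show "(\<Union>n. X closure_of N n) \<subseteq> topspace X"
      by (intro UN_least closure_of_subset_topspace)
    have "N n \<subseteq> X closure_of N n" for n
      using N(1) by (intro closure_of_subset) (auto simp: nowhere_dense_in_def)
    then show "topspace X \<subseteq> (\<Union>n. X closure_of N n)"
      unfolding N(2) by (intro UN_mono) auto
  qed
  ultimately show False using assms(2) by simp
qed

lemma dense_in_itself_image_cylinder:
  assumes f: "continuous_map baire_space X f" "inj f"
  shows "dense_in_itself X (f ` cylinder s)"
  unfolding dense_in_itself_def
proof
  fix y assume "y \<in> f ` cylinder s"
  then obtain x where x: "x \<in> cylinder s" "y = f x" by auto
  show "y \<in> X derived_set_of (f ` cylinder s)"
    unfolding in_derived_set_of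
  proof (intro conjI allI impI)
    show "y \<in> topspace X" using f(1) x(2) by (auto simp: continuous_map_def)
    fix U assume U: "y \<in> U \<and> openin X U"
    have "openin baire_space {z \<in> topspace baire_space. f z \<in> U}"
      using f(1) U by (intro openin_continuous_map_preimage) auto
    then have "openin baire_space (cylinder s \<inter> {z \<in> topspace baire_space. f z \<in> U})"
      by (intro openin_Int openin_cylinder)
    moreover have "x \<in> cylinder s \<inter> {z \<in> topspace baire_space. f z \<in> U}" using x U by simp
    ultimately obtain z where "z \<in> cylinder s \<inter> {z \<in> topspace baire_space. f z \<in> U}" "z \<noteq> x"
      by (rule no_isolated_points_baire_space)
    then show "\<exists>z. z \<noteq> y \<and> z \<in> f ` cylinder s \<and> z \<in> U"
      using x(2) f(2) by (auto simp: inj_eq intro!: exI[of _ "f z"])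
  qed
qed

lemma perfect_set_in_closure_of:
  assumes "dense_in_itself X S" "S \<noteq> {}"
  shows "perfect_set_in X (X closure_of S)"
proof -
  have "S \<subseteq> X closure_of S"
    using assms(1) by (intro closure_of_subset dense_in_itself_subset_topspace)
  then have "dense_in_itself X (X closure_of S)"
    by (intro dense_in_itself_between_closure[OF assms(1)]) auto
  with \<open>S \<subseteq> X closure_of S\<close> assms(2) show ?thesis
    unfolding perfect_set_in_def
    using dense_in_itself_iff_no_isolated_points[OF closure_of_subset_topspace, of X S] by auto
qed

text \<open>
  Apply the hypothesis to the perfect sets \<open>P s\<close>, the closures of the images of cylinders. If the
  preimage of a closed part \<open>C n\<close> of the resulting \<open>F\<^sub>\<sigma>\<close> set \<open>F\<close> contained a cylinder, \<open>C n\<close> would contain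
  some \<open>P s\<close>, which would then be meager in itself.
\<close>

lemma countably_perfectly_meager_imp_nowhere_dense_preimages:
  assumes X: "completely_metrizable_space X" and A: "countably_perfectly_meager_in X A"
    and f: "continuous_map baire_space X f" "inj f"
  obtains F :: "nat \<Rightarrow> 'a set" where "\<And>n. closedin X (F n)" "A \<subseteq> (\<Union>n. F n)"
    "\<And>n. nowhere_dense_in baire_space (f -` F n)"
proof -
  define P where "P s = X closure_of (f ` cylinder s)" for s
  have perfP: "perfect_set_in X (P s)" for s
    unfolding P_def using dense_in_itself_image_cylinder[OF f] cylinder_nonempty
    by (intro perfect_set_in_closure_of) auto
  then have "\<forall>n. perfect_set_in X ((P \<circ> from_nat) n)" by simp
  then obtain F where F: "fsigma_in X F" "A \<subseteq> F"
    "\<And>n. meager_in (subtopology X ((P \<circ> from_nat) n)) (F \<inter> (P \<circ> from_nat) n)"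
    using A unfolding countably_perfectly_meager_in_def by metis
  have meager: "meager_in (subtopology X (P s)) (F \<inter> P s)" for s
    using F(3)[of "to_nat s"] by simp
  obtain C :: "nat \<Rightarrow> 'a set" where C: "\<And>n. closedin X (C n)" "(\<Union>n. C n) = F"
    using F(1) unfolding fsigma_in_ascending by metis
  have "nowhere_dense_in baire_space (f -` C n)" for n
  proof -
    have "closedin baire_space {x \<in> topspace baire_space. f x \<in> C n}"
      by (rule closedin_continuous_map_preimage[OF f(1) C(1)])
    moreover have "{x \<in> topspace baire_space. f x \<in> C n} = f -` C n" by auto
    ultimately have cl: "baire_space closure_of (f -` C n) = f -` C n"
      by (simp add: closure_of_closedin)
    have "baire_space interior_of (f -` C n) = {}"
    proof (rule ccontr)
      assume "baire_space interior_of (f -` C n) \<noteq> {}"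
      then obtain x where "x \<in> baire_space interior_of (f -` C n)" by auto
      then obtain m where "cylinder (rprefix x m) \<subseteq> baire_space interior_of (f -` C n)"
        using openin_baire_space_contains_cylinder[OF openin_interior_of] by metis
      also have "\<dots> \<subseteq> f -` C n" by (rule interior_of_subset)
      finally have "f ` cylinder (rprefix x m) \<subseteq> C n" by auto
      then have "P (rprefix x m) \<subseteq> C n"
        unfolding P_def using C(1) by (rule closure_of_minimal)
      then have "F \<inter> P (rprefix x m) = P (rprefix x m)" using C(2) by auto
      moreover have "P (rprefix x m) = topspace (subtopology X (P (rprefix x m)))"
        unfolding P_def using closure_of_subset_topspace[of X] by (simp add: Int_absorb1)
      ultimately have "meager_in (subtopology X (P (rprefix x m))) (topspace (subtopology X (P (rprefix x m))))"
        using meager[of "rprefix x m"] by metis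
      moreover have "completely_metrizable_space (subtopology X (P (rprefix x m)))"
        using X perfP by (intro completely_metrizable_space_closedin) (auto simp: perfect_set_in_def)
      moreover have "P (rprefix x m) \<noteq> {}" using perfP by (auto simp: perfect_set_in_def)
      ultimately show False
        using not_meager_in_topspace \<open>P (rprefix x m) = topspace _\<close> by metis
    qed
    then show ?thesis by (simp add: nowhere_dense_in_def cl)
  qed
  with C F(2) that show thesis by metis
qed

text \<open>
  Choose the bijection so that the preimage of the closure of every nonempty set \<open>P n \<inter> b j\<close>, with
  \<open>b\<close> enumerating a base, has nonempty interior. A closed set that contains a nonempty relatively open
  part of some \<open>P n\<close> contains one of these closures, so its preimage is not nowhere dense.
\<close>

lemma nowhere_dense_preimages_imp_countably_perfectly_meager:
  assumes X: "perfect_polish_space X" and A: "A \<subseteq> topspace X"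
    and cover: "\<And>f :: (nat \<Rightarrow> nat) \<Rightarrow> 'a.
      continuous_map baire_space X f \<Longrightarrow> bij_betw f UNIV (topspace X) \<Longrightarrow>
      \<exists>F :: nat \<Rightarrow> 'a set. (\<forall>n. closedin X (F n)) \<and> A \<subseteq> (\<Union>n. F n) \<and>
        (\<forall>n. nowhere_dense_in baire_space (f -` F n))"
  shows "countably_perfectly_meager_in X A"
  unfolding countably_perfectly_meager_in_def
proof (intro conjI allI impI)
  show "A \<subseteq> topspace X" by (rule A)
  fix P :: "nat \<Rightarrow> 'a set" assume "\<forall>n. perfect_set_in X (P n)"
  then have P: "P n \<noteq> {}" "closedin X (P n)" "no_isolated_points (subtopology X (P n))" for n
    by (auto simp: perfect_set_in_def)
  have PX: "P n \<subseteq> topspace X" for n using P(2) by (rule closedin_subset)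
  have diiP: "dense_in_itself X (P n)" for n
    using P(3) dense_in_itself_iff_no_isolated_points[OF PX] by auto
  have ne: "topspace X \<noteq> {}" using P(1) PX by (metis subset_empty)
  have cm: "completely_metrizable_space X" using X by (simp add: perfect_polish_space_def)
  have diiX: "dense_in_itself X (topspace X)"
    using X dense_in_itself_iff_no_isolated_points[of "topspace X" X]
    by (simp add: perfect_polish_space_def)
  have sc: "second_countable X" using X by (rule perfect_polish_space_second_countable)
  then obtain \<B> where \<B>: "countable \<B>" "\<And>b. b \<in> \<B> \<Longrightarrow> openin X b"
    "\<And>U x. openin X U \<Longrightarrow> x \<in> U \<Longrightarrow> \<exists>b\<in>\<B>. x \<in> b \<and> b \<subseteq> U"
    unfolding second_countable_def by metis
  obtain p where "p \<in> topspace X" using ne by (meson ex_in_conv)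
  then have "\<B> \<noteq> {}" using \<B>(3)[OF openin_topspace, of p] by auto
  define b where "b = from_nat_into \<B>"
  have range_b: "range b = \<B>"
    unfolding b_def using \<open>\<B> \<noteq> {}\<close> \<B>(1) by (rule range_from_nat_into)
  have openb: "openin X (b j)" for j using \<B>(2) range_b by auto
  define R where "R n j = X closure_of (P n \<inter> b j)" for n j
  have R_sub: "P n \<inter> b j \<subseteq> R n j" for n j
    unfolding R_def using PX by (intro closure_of_subset) auto
  define Q where "Q k = (case prod_decode k of (n, j) \<Rightarrow> R n j)" for k
  have closedQ: "closedin X (Q k)" for k by (simp add: Q_def R_def split: prod.split)
  have diiR: "dense_in_itself X (R n j)" for n j
    by (rule dense_in_itself_between_closure[OF dense_in_itself_openin_Int[OF diiP openb] R_sub])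
      (simp add: R_def)
  then have diiQ: "dense_in_itself X (Q k)" for k by (simp add: Q_def split: prod.split)
  obtain f where f: "continuous_map baire_space X f" "bij_betw f UNIV (topspace X)"
    "\<And>k. Q k \<noteq> {} \<Longrightarrow> \<exists>s. cylinder s \<subseteq> f -` Q k"
    using continuous_bijection_with_fat_preimages[where Q = Q, OF cm sc ne diiX closedQ diiQ] by metis
  obtain F :: "nat \<Rightarrow> 'a set" where F: "\<And>n. closedin X (F n)" "A \<subseteq> (\<Union>n. F n)"
    "\<And>n. nowhere_dense_in baire_space (f -` F n)"
    using cover[OF f(1,2)] by metis
  have nwd: "nowhere_dense_in (subtopology X (P n)) (F m \<inter> P n)" for m n
  proof -
    define S where "S = subtopology X (P n)"
    have "closedin S (F m \<inter> P n)"
      unfolding S_def using F(1) by (auto simp: closedin_subtopology)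
    then have cl: "S closure_of (F m \<inter> P n) = F m \<inter> P n" by (rule closure_of_closedin)
    have "S interior_of (F m \<inter> P n) = {}"
    proof (rule ccontr)
      assume "S interior_of (F m \<inter> P n) \<noteq> {}"
      then obtain x W where "openin S W" "x \<in> W" "W \<subseteq> F m \<inter> P n"
        unfolding interior_of_def by auto
      then obtain U where U: "openin X U" "x \<in> U" "x \<in> P n" "U \<inter> P n \<subseteq> F m"
        unfolding S_def openin_subtopology by auto
      then obtain j where j: "x \<in> b j" "b j \<subseteq> U"
        using \<B>(3)[OF U(1,2)] range_b by (metis rangeE)
      have "P n \<inter> b j \<subseteq> F m" using j(2) U(4) by auto
      then have "R n j \<subseteq> F m" unfolding R_def using F(1) by (rule closure_of_minimal)
      moreover have "R n j \<noteq> {}" using R_sub[of n j] U(3) j(1) by auto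
      moreover have "R n j = Q (prod_encode (n, j))" by (simp add: Q_def)
      ultimately obtain s where "cylinder s \<subseteq> f -` F m"
        using f(3)[of "prod_encode (n, j)"] by (metis order_trans vimage_mono)
      also have "\<dots> \<subseteq> baire_space closure_of (f -` F m)" by (rule closure_of_subset) simp
      finally have "cylinder s \<subseteq> baire_space interior_of (baire_space closure_of (f -` F m))"
        by (rule interior_of_maximal) (rule openin_cylinder)
      with F(3) cylinder_nonempty show False by (auto simp: nowhere_dense_in_def)
    qed
    then show ?thesis
      using PX by (auto simp: nowhere_dense_in_def cl[unfolded S_def] S_def)
  qed
  show "\<exists>F. fsigma_in X F \<and> A \<subseteq> F \<and> (\<forall>n. meager_in (subtopology X (P n)) (F \<inter> P n))"
  proof (intro exI conjI allI)
    show "fsigma_in X (\<Union>n. F n)"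
      using F(1) by (intro fsigma_in_Union) (auto intro: closed_imp_fsigma_in)
    show "A \<subseteq> (\<Union>n. F n)" by (rule F(2))
    show "meager_in (subtopology X (P n)) ((\<Union>n. F n) \<inter> P n)" for n
      unfolding meager_in_def
      by (rule exI[of _ "\<lambda>m. F m \<inter> P n"]) (simp add: nwd)
  qed
qed

theorem theorem2p5:
  fixes X :: "'a topology" and A :: "'a set"
  assumes "perfect_polish_space X" and "A \<subseteq> topspace X"
  shows "countably_perfectly_meager_in X A \<longleftrightarrow>
    (\<forall>f :: (nat \<Rightarrow> nat) \<Rightarrow> 'a.
      continuous_map baire_space X f \<and> bij_betw f (topspace baire_space) (topspace X) \<longrightarrow>
      (\<exists>F :: nat \<Rightarrow> 'a set.
        (\<forall>n. closedin X (F n)) \<and> A \<subseteq> (\<Union>n. F n) \<and>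
        (\<forall>n. nowhere_dense_in baire_space (f -` F n))))"
proof (intro iffI allI impI)
  fix f :: "(nat \<Rightarrow> nat) \<Rightarrow> 'a"
  assume A: "countably_perfectly_meager_in X A"
    and f: "continuous_map baire_space X f \<and> bij_betw f (topspace baire_space) (topspace X)"
  have "completely_metrizable_space X" using assms(1) by (simp add: perfect_polish_space_def)
  moreover have "inj f" using f by (simp add: bij_betw_def)
  ultimately obtain F :: "nat \<Rightarrow> 'a set" where "\<And>n. closedin X (F n)" "A \<subseteq> (\<Union>n. F n)"
    "\<And>n. nowhere_dense_in baire_space (f -` F n)"
    using countably_perfectly_meager_imp_nowhere_dense_preimages[OF _ A] f by metis
  then show "\<exists>F :: nat \<Rightarrow> 'a set. (\<forall>n. closedin X (F n)) \<and> A \<subseteq> (\<Union>n. F n) \<and>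
      (\<forall>n. nowhere_dense_in baire_space (f -` F n))"
    by metis
next
  assume "\<forall>f :: (nat \<Rightarrow> nat) \<Rightarrow> 'a.
      continuous_map baire_space X f \<and> bij_betw f (topspace baire_space) (topspace X) \<longrightarrow>
      (\<exists>F :: nat \<Rightarrow> 'a set. (\<forall>n. closedin X (F n)) \<and> A \<subseteq> (\<Union>n. F n) \<and>
        (\<forall>n. nowhere_dense_in baire_space (f -` F n)))"
  then show "countably_perfectly_meager_in X A"
    using assms by (intro nowhere_dense_preimages_imp_countably_perfectly_meager) simp_all
qed

end
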